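(* Fix $T>0$ and let $u(\cdot,t)\in C^3(I)$ be a classical solution, for $t\in[0,T]$, of the initial boundary value problem $$u_t+f(u)_x=\left(\frac{\varepsilon u_x}{\sqrt{1-\varepsilon^2u_x^2}}\right)_x\ \ (x\in I,\ t>0),\qquad u(\pm\ell,t)=u_\pm\ \ (t\ge0),\qquad u(x,0)=u_0(x)\ \ (x\in I).$$ If $$\|u_0'\|_{L^\infty}<\varepsilon^{-1},$$ then $$\|u(\cdot,t)\|_{L^\infty}\le\|u_0\|_{L^\infty}\qquad\text{and}\qquad\|u_x(\cdot,t)\|_{L^\infty}<\varepsilon^{-1}$$ for any $t\in[0,T]$.
   Context: $\ell>0$, $I=(-\ell,\ell)$, $\varepsilon>0$, $f\in C^2(\mathbb{R})$, $u_\pm\in\mathbb{R}$, and $L^\infty=L^\infty(I)$. *)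

theory Defs
  imports "HOL-Analysis.Analysis" "HOL-Probability.Essential_Supremum"
begin

(* Intended for open S. *)
definition Ck_on :: "nat \<Rightarrow> real set \<Rightarrow> (real \<Rightarrow> real) \<Rightarrow> bool" where
  "Ck_on k S g \<longleftrightarrow>
     (\<forall>j<k. \<forall>x\<in>S. (deriv ^^ j) g field_differentiable (at x)) \<and>
     continuous_on S ((deriv ^^ k) g)"

(* Extended-real valued; only the values of g on S matter. *)
definition Linf_norm :: "real set \<Rightarrow> (real \<Rightarrow> real) \<Rightarrow> ereal" where
  "Linf_norm S g = esssup (lebesgue_on S) (\<lambda>x. ereal \<bar>g x\<bar>)"

definition u_x :: "(real \<Rightarrow> real \<Rightarrow> real) \<Rightarrow> real \<Rightarrow> real \<Rightarrow> real" where
  "u_x u x t = deriv (\<lambda>y. u y t) x"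

definition mc_flux :: "real \<Rightarrow> real \<Rightarrow> real" where
  "mc_flux \<epsilon> p = \<epsilon> * p / sqrt (1 - \<epsilon>\<^sup>2 * p\<^sup>2)"

(* C^{2,1} in I x (0,T] and C^0 on the closed cylinder, I = (-l,l). The time derivative is
   one-sided at t = T. Continuity up to the corners makes the boundary values compatible with u0.

   The equation only has a meaning where 1 - eps^2 u_x^2 > 0. This is not made a separate
   requirement, since it would build the non-strict pointwise form of the gradient bound into
   the notion of solution. Where the inequality fails, the equation refers to Isabelle's totalised
   division and sqrt; so every solution with 1 - eps^2 u_x^2 > 0 is a solution in the present
   sense. *)
definition classical_solution ::
  "real \<Rightarrow> real \<Rightarrow> (real \<Rightarrow> real) \<Rightarrow> real \<Rightarrow> real \<Rightarrow> (real \<Rightarrow> real) \<Rightarrow> real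
    \<Rightarrow> (real \<Rightarrow> real \<Rightarrow> real) \<Rightarrow> bool" where
  "classical_solution l \<epsilon> f um up u0 T u \<longleftrightarrow>
     continuous_on ({-l..l} \<times> {0..T}) (\<lambda>(x, t). u x t) \<and>
     (\<forall>t\<in>{0<..T}. Ck_on 2 {-l<..<l} (\<lambda>x. u x t)) \<and>
     continuous_on ({-l<..<l} \<times> {0<..T}) (\<lambda>(x, t). u_x u x t) \<and>
     continuous_on ({-l<..<l} \<times> {0<..T}) (\<lambda>(x, t). u_x (u_x u) x t) \<and>
     (\<exists>ut. continuous_on ({-l<..<l} \<times> {0<..T}) (\<lambda>(x, t). ut x t) \<and>
        (\<forall>x\<in>{-l<..<l}. \<forall>t\<in>{0<..T}.
           ((\<lambda>s. u x s) has_real_derivative ut x t) (at t within {0..T}) \<and>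
           ((\<lambda>y. mc_flux \<epsilon> (u_x u y t)) has_real_derivative
              (ut x t + deriv (\<lambda>y. f (u y t)) x)) (at x))) \<and>
     (\<forall>t\<in>{0..T}. u (-l) t = um \<and> u l t = up) \<and>
     (\<forall>x\<in>{-l<..<l}. u x 0 = u0 x)"

end

theory Submission
  imports Defs
begin

text \<open>
  Write \<open>F\<close> for the saturating flux, \<open>p = u\<^sub>x\<close> and \<open>q = F(p) - f(u)\<close>, so that the equation
  reads \<open>u\<^sub>t = q\<^sub>x\<close>. The difficulty is that \<open>u\<^sub>x\<close> may have no limit at the lateral boundary, so
  that the gradient has to be controlled through \<open>u\<close> itself. Three observations give the result.

  \<^item> \<^emph>\<open>Pointwise subcriticality.\<close> \<open>F\<close> maps the interval \<open>\<bar>p\<bar> < 1/\<epsilon>\<close> bijectively onto the line, with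
    inverse \<open>G(z) = z / (\<epsilon> sqrt (1 + z\<^sup>2))\<close>, and blows up at its ends. As \<open>F(u\<^sub>x(\<cdot>,t))\<close> is
    continuous, \<open>\<bar>u\<^sub>x(\<cdot>,t)\<bar>\<close> cannot cross the value \<open>1/\<epsilon>\<close>; as the boundary values of \<open>u\<close> do not
    depend on time, the mean value theorem provides at every time a point with
    \<open>\<bar>u\<^sub>x\<bar> \<le> sup \<bar>u\<^sub>0'\<bar> < 1/\<epsilon>\<close>.

  \<^item> \<^emph>\<open>Sup bound.\<close> This is the classical maximum principle for \<open>u\<close>, and for \<open>-u\<close>, which solves the
    equation with the flux function \<open>s \<mapsto> -f(-s)\<close>.

  \<^item> \<^emph>\<open>Uniform gradient bound.\<close> Formally, \<open>q\<close> satisfies the parabolic equation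
    \<open>q\<^sub>t = F'(u\<^sub>x) q\<^sub>x\<^sub>x - f'(u) q\<^sub>x\<close> without source term, so a bound \<open>q \<le> c\<close> would propagate from
    the initial and lateral data. But \<open>q\<close> need not be twice differentiable, nor is it defined at
    the lateral boundary. Both problems disappear after integration. The inequality
    \<open>F(u\<^sub>x) \<le> f(u) + c\<close> says \<open>u\<^sub>x \<le> G(f(u) + c)\<close>, that is, \<open>v\<^sub>x \<le> 1\<close> for \<open>v = \<phi>(u)\<close> and
    \<open>\<phi>' = 1 / G(f + c)\<close>; equivalently \<open>v(y,t) - v(x,t) \<le> y - x\<close> for \<open>x \<le> y\<close>. This two-point
    inequality is propagated by a maximum principle in the variables \<open>(x, y, t)\<close>: at a positive
    maximum of the difference, \<open>v\<^sub>x = 1\<close> and hence \<open>q = c\<close> at those of the two points that are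
    interior, extremality fixes the sign of \<open>q\<^sub>x = u\<^sub>t\<close> there, and at a lateral point
    \<open>v\<^sub>t = 0\<close> anyway. Taking \<open>c\<close> large makes the inequality true at time \<open>0\<close>, precisely because
    \<open>sup \<bar>u\<^sub>0'\<bar> < 1/\<epsilon>\<close>; at later times it yields \<open>u\<^sub>x \<le> G(C) < 1/\<epsilon>\<close>, where \<open>C\<close> bounds
    \<open>f(u) + c\<close>. The lower bound follows by passing to \<open>-u\<close> again.
\<close>

section \<open>The saturating flux and its inverse\<close>

definition mc_slope :: "real \<Rightarrow> real \<Rightarrow> real" where
  "mc_slope \<epsilon> z = z / (\<epsilon> * sqrt (1 + z\<^sup>2))"

lemma mc_slope_sin: "mc_slope \<epsilon> z = sin (arctan z) / \<epsilon>"
  by (simp add: mc_slope_def sin_arctan)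

lemma mc_flux_tan:
  assumes "\<epsilon> > 0" "\<bar>p\<bar> < inverse \<epsilon>"
  shows "\<bar>\<epsilon> * p\<bar> < 1" "mc_flux \<epsilon> p = tan (arcsin (\<epsilon> * p))"
proof -
  show *: "\<bar>\<epsilon> * p\<bar> < 1"
    using assms by (simp add: abs_mult field_simps)
  show "mc_flux \<epsilon> p = tan (arcsin (\<epsilon> * p))"
    using * by (simp add: mc_flux_def tan_def cos_arcsin power_mult_distrib)
qed

lemma abs_mc_slope:
  assumes "\<epsilon> > 0"
  shows "\<bar>mc_slope \<epsilon> z\<bar> < inverse \<epsilon>"
proof -
  have "\<bar>z\<bar> < sqrt (1 + z\<^sup>2)"
    by (rule real_less_rsqrt) simp
  moreover have "0 < sqrt (1 + z\<^sup>2)"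
    by (simp add: add_pos_nonneg)
  ultimately show ?thesis
    using assms by (simp add: mc_slope_def abs_mult field_simps)
qed

lemma mc_flux_slope:
  assumes "\<epsilon> > 0"
  shows "mc_flux \<epsilon> (mc_slope \<epsilon> z) = z"
proof -
  have "\<epsilon> * mc_slope \<epsilon> z = sin (arctan z)"
    using assms by (simp add: mc_slope_sin)
  moreover have "arcsin (sin (arctan z)) = arctan z"
    using arctan_bounded[of z] by (intro arcsin_sin) auto
  ultimately show ?thesis
    using mc_flux_tan(2)[OF assms abs_mc_slope[OF assms]] by (simp add: tan_arctan)
qed

lemma mc_flux_strict_mono:
  assumes "\<epsilon> > 0" "\<bar>p\<bar> < inverse \<epsilon>" "\<bar>r\<bar> < inverse \<epsilon>" "p < r"
  shows "mc_flux \<epsilon> p < mc_flux \<epsilon> r"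
proof -
  note p = mc_flux_tan[OF assms(1,2)] and r = mc_flux_tan[OF assms(1,3)]
  have "arcsin (\<epsilon> * p) < arcsin (\<epsilon> * r)"
    using assms p(1) r(1) by (intro arcsin_less_arcsin) auto
  moreover have "- (pi/2) < arcsin (\<epsilon> * p)" "arcsin (\<epsilon> * r) < pi/2"
    using p(1) r(1) arcsin_lt_bounded[of "\<epsilon> * p"] arcsin_lt_bounded[of "\<epsilon> * r"] by auto
  ultimately show ?thesis
    unfolding p(2) r(2) by (intro tan_monotone)
qed

lemma sgn_mc_flux_diff:
  assumes "\<epsilon> > 0" "\<bar>p\<bar> < inverse \<epsilon>"
  shows "sgn (mc_flux \<epsilon> p - z) = sgn (p - mc_slope \<epsilon> z)"
proof -
  consider "p < mc_slope \<epsilon> z" | "p = mc_slope \<epsilon> z" | "p > mc_slope \<epsilon> z"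
    by linarith
  then show ?thesis
  proof cases
    case 1
    with mc_flux_strict_mono[OF assms(1,2) abs_mc_slope[OF assms(1), of z]]
    show ?thesis by (simp add: mc_flux_slope assms)
  next
    case 2
    then show ?thesis by (simp add: mc_flux_slope assms)
  next
    case 3
    with mc_flux_strict_mono[OF assms(1) abs_mc_slope[OF assms(1), of z] assms(2)]
    show ?thesis by (simp add: mc_flux_slope assms)
  qed
qed

lemma mc_slope_le_iff:
  assumes "\<epsilon> > 0" "\<bar>p\<bar> < inverse \<epsilon>"
  shows "p \<le> mc_slope \<epsilon> z \<longleftrightarrow> mc_flux \<epsilon> p \<le> z"
  using sgn_mc_flux_diff[OF assms, of z] by (auto simp: sgn_if split: if_splits)

lemma mc_slope_ge_iff:
  assumes "\<epsilon> > 0" "\<bar>p\<bar> < inverse \<epsilon>"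
  shows "mc_slope \<epsilon> z \<le> p \<longleftrightarrow> z \<le> mc_flux \<epsilon> p"
  using sgn_mc_flux_diff[OF assms, of z] by (auto simp: sgn_if split: if_splits)

lemma mc_slope_flux:
  assumes "\<epsilon> > 0" "\<bar>p\<bar> < inverse \<epsilon>"
  shows "mc_slope \<epsilon> (mc_flux \<epsilon> p) = p"
  using mc_slope_le_iff[OF assms, of "mc_flux \<epsilon> p"] mc_slope_ge_iff[OF assms, of "mc_flux \<epsilon> p"]
  by auto

lemma mc_slope_mono:
  assumes "\<epsilon> > 0" "y \<le> z"
  shows "mc_slope \<epsilon> y \<le> mc_slope \<epsilon> z"
  using assms by (simp add: mc_slope_le_iff abs_mc_slope mc_flux_slope)

lemma mc_flux_minus: "mc_flux \<epsilon> (- p) = - mc_flux \<epsilon> p"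
  by (simp add: mc_flux_def)

lemma continuous_on_mc_slope:
  assumes "\<epsilon> > 0" "continuous_on S g"
  shows "continuous_on S (\<lambda>x. mc_slope \<epsilon> (g x))"
proof -
  have "sqrt (1 + z\<^sup>2) \<noteq> 0" for z :: real
    using zero_le_power2[of z] by (simp add: add_nonneg_eq_0_iff)
  then show ?thesis
    unfolding mc_slope_def using assms by (intro continuous_intros) auto
qed

text \<open>
  The subcritical set \<open>\<bar>p\<bar> < 1/\<epsilon>\<close> is open, but it is also where the two continuous functions
  \<open>p\<close> and \<open>G(F(p))\<close> agree, because \<open>\<bar>G\<bar> < 1/\<epsilon>\<close>; hence it is closed as well,
  whatever values \<open>F\<close> takes outside the subcritical interval.
\<close>

lemma subcritical_on_connected:
  assumes "\<epsilon> > 0" "connected S" "continuous_on S p" "continuous_on S (\<lambda>x. mc_flux \<epsilon> (p x))"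
    and "\<xi> \<in> S" "\<bar>p \<xi>\<bar> < inverse \<epsilon>" "x \<in> S"
  shows "\<bar>p x\<bar> < inverse \<epsilon>"
proof -
  define A where "A = {x \<in> S. \<bar>p x\<bar> < inverse \<epsilon>}"
  have A_open: "A = S \<inter> (\<lambda>x. \<bar>p x\<bar>) -` {..<inverse \<epsilon>}"
    by (auto simp: A_def)
  have "continuous_on S (\<lambda>x. \<bar>p x\<bar>)"
    using assms by (intro continuous_intros)
  then have "openin (top_of_set S) A"
    unfolding A_open by (rule continuous_openin_preimage_gen) simp
  have A_closed: "A = S \<inter> (\<lambda>x. p x - mc_slope \<epsilon> (mc_flux \<epsilon> (p x))) -` {0}"
    using abs_mc_slope[OF \<open>\<epsilon> > 0\<close>] mc_slope_flux[OF \<open>\<epsilon> > 0\<close>] by (auto simp: A_def) metis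
  have "continuous_on S (\<lambda>x. p x - mc_slope \<epsilon> (mc_flux \<epsilon> (p x)))"
    using assms by (intro continuous_intros continuous_on_mc_slope)
  then have "closedin (top_of_set S) A"
    unfolding A_closed by (rule continuous_closedin_preimage) simp
  with \<open>openin (top_of_set S) A\<close> assms(2) have "A = {} \<or> A = S"
    unfolding connected_clopen by blast
  with assms(5-7) show ?thesis
    by (auto simp: A_def)
qed

section \<open>Maximum principles\<close>

text \<open>
  If \<open>D\<close> were positive, \<open>Q\<close> and with it \<open>w'\<close> would be positive just to the right of \<open>x\<close>, so \<open>w\<close>
  would exceed its maximum there. Applied to a flux \<open>Q\<close>, this gives the sign of the
  diffusion term at an extremum without second derivatives of the solution.
\<close>

lemma flux_derivative_at_max:
  fixes w w' Q :: "real \<Rightarrow> real"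
  assumes x: "x \<in> {a<..<b}"
    and dw: "\<And>y. y \<in> {a<..<b} \<Longrightarrow> (w has_real_derivative w' y) (at y)"
    and sg: "\<And>y. y \<in> {a<..<b} \<Longrightarrow> sgn (Q y) = sgn (w' y)"
    and dQ: "(Q has_real_derivative D) (at x)"
    and max: "\<And>y. y \<in> {a<..<b} \<Longrightarrow> w y \<le> w x"
  shows "w' x = 0" "D \<le> 0"
proof -
  define d where "d = min (x - a) (b - x)"
  have d: "d > 0" "\<And>y. \<bar>x - y\<bar> < d \<Longrightarrow> y \<in> {a<..<b}"
    using x by (auto simp: d_def)
  show w0: "w' x = 0"
    using DERIV_local_max[OF dw[OF x] d(1)] d(2) max by blast
  have Q0: "Q x = 0"
    using sg[OF x] w0 by (simp add: sgn_zero_iff)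
  show "D \<le> 0"
  proof (rule ccontr)
    assume "\<not> D \<le> 0"
    then obtain e where e: "e > 0" "\<And>h. 0 < h \<Longrightarrow> h < e \<Longrightarrow> Q x < Q (x + h)"
      using has_real_derivative_pos_inc_right[OF dQ] by auto
    define h where "h = min d e / 2"
    have h: "0 < h" "h < d" "h < e"
      using d e by (auto simp: h_def)
    have pos: "w' y > 0" if "x < y" "y < x + h" for y
      using e(2)[of "y - x"] sg[of y] d(2)[of y] that h Q0 by (auto simp: sgn_if split: if_splits)
    have "w x < w (x + h)"
    proof (rule DERIV_pos_imp_increasing_open[of x "x + h" w])
      show "\<exists>D. (w has_real_derivative D) (at y) \<and> 0 < D" if "x < y" "y < x + h" for y
        using dw[of y] pos[of y] d(2)[of y] that h by auto
      show "continuous_on {x..x + h} w"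
        using d(2) h by (intro continuous_at_imp_continuous_on ballI DERIV_isCont[OF dw]) auto
    qed (use h in auto)
    then show False
      using max[of "x + h"] d(2)[of "x + h"] h by auto
  qed
qed

lemma time_derivative_at_max:
  fixes g :: "real \<Rightarrow> real"
  assumes "(g has_real_derivative D) (at t within {0..T})" "t \<in> {0<..T}"
    and "\<And>s. s \<in> {0..T} \<Longrightarrow> g s \<le> g t"
  shows "D \<ge> 0"
proof (rule ccontr)
  assume "\<not> D \<ge> 0"
  then obtain d where d: "d > 0" "\<And>h. 0 < h \<Longrightarrow> t - h \<in> {0..T} \<Longrightarrow> h < d \<Longrightarrow> g t < g (t - h)"
    using has_real_derivative_neg_dec_left[OF assms(1)] by auto
  define h where "h = min d t / 2"
  have "0 < h" "h < d" "t - h \<in> {0..T}"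
    using d assms(2) by (auto simp: h_def)
  then show False
    using d(2)[of h] assms(3)[of "t - h"] by auto
qed

text \<open>
  \<open>Q\<close> plays the role of a flux which drives \<open>v\<close> (the sign of \<open>v\<^sub>t\<close> is that of \<open>Q\<^sub>x\<close>) and which
  vanishes exactly at slope one. The term \<open>\<eta> t\<close> makes the violation of the claim increase strictly
  in time at the maximum. At lateral points, \<open>v\<close> is stationary,
  which replaces the argument about slopes.
\<close>

lemma two_point_maximum_principle:
  fixes v vx vt Q :: "real \<Rightarrow> real \<Rightarrow> real"
  assumes cont: "continuous_on ({a..b} \<times> {0..T}) (\<lambda>(x, t). v x t)"
    and time: "\<And>x t. x \<in> {a<..<b} \<Longrightarrow> t \<in> {0<..T} \<Longrightarrow>
        ((\<lambda>s. v x s) has_real_derivative vt x t) (at t within {0..T})"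
    and space: "\<And>x t. x \<in> {a<..<b} \<Longrightarrow> t \<in> {0<..T} \<Longrightarrow>
        ((\<lambda>y. v y t) has_real_derivative vx x t) (at x)"
    and sgn_flux: "\<And>x t. x \<in> {a<..<b} \<Longrightarrow> t \<in> {0<..T} \<Longrightarrow> sgn (Q x t) = sgn (vx x t - 1)"
    and flux: "\<And>x t. x \<in> {a<..<b} \<Longrightarrow> t \<in> {0<..T} \<Longrightarrow>
        \<exists>D. ((\<lambda>y. Q y t) has_real_derivative D) (at x) \<and> sgn D = sgn (vt x t)"
    and lateral: "\<And>t. t \<in> {0..T} \<Longrightarrow> v a t = v a 0" "\<And>t. t \<in> {0..T} \<Longrightarrow> v b t = v b 0"
    and init: "\<And>x y. a \<le> x \<Longrightarrow> x \<le> y \<Longrightarrow> y \<le> b \<Longrightarrow> v y 0 - v x 0 \<le> y - x"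
    and xyt: "a \<le> x" "x \<le> y" "y \<le> b" "t \<in> {0..T}"
  shows "v y t - v x t \<le> y - x"
proof (rule ccontr)
  assume "\<not> v y t - v x t \<le> y - x"
  then have viol: "v y t - v x t - (y - x) > 0" by simp
  define \<eta> where "\<eta> = (v y t - v x t - (y - x)) / (T + 1)"
  have \<eta>: "\<eta> > 0" "v y t - v x t - (y - x) - \<eta> * t > 0"
  proof -
    have "T + 1 > 0" "T + 1 - t > 0"
      using xyt(4) by auto
    then show "\<eta> > 0"
      using viol by (simp add: \<eta>_def)
    moreover have "v y t - v x t - (y - x) = \<eta> * (T + 1)"
      using \<open>T + 1 > 0\<close> by (simp add: \<eta>_def)
    ultimately show "v y t - v x t - (y - x) - \<eta> * t > 0"
      using mult_pos_pos[OF \<open>\<eta> > 0\<close> \<open>T + 1 - t > 0\<close>] by (simp add: algebra_simps)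
  qed
  define K where "K = ({a..b} \<times> {a..b} \<times> {0..T}) \<inter> {z. fst z \<le> fst (snd z)}"
  define \<Phi> where "\<Phi> = (\<lambda>z. v (fst (snd z)) (snd (snd z)) - v (fst z) (snd (snd z))
    - (fst (snd z) - fst z) - \<eta> * snd (snd z))"
  have "closed {z :: real \<times> real \<times> real. fst z \<le> fst (snd z)}"
    by (intro closed_Collect_le continuous_intros)
  then have "compact K"
    unfolding K_def by (intro compact_Int_closed compact_Times) auto
  moreover have "(x, y, t) \<in> K"
    using xyt by (simp add: K_def)
  moreover have "continuous_on K \<Phi>"
  proof -
    have "continuous_on K (\<lambda>z. v (fst (snd z)) (snd (snd z)))"
      by (rule continuous_on_compose2[OF cont[unfolded case_prod_unfold], of K
            "\<lambda>z. (fst (snd z), snd (snd z))", simplified]) (auto simp: K_def intro!: continuous_intros)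
    moreover have "continuous_on K (\<lambda>z. v (fst z) (snd (snd z)))"
      by (rule continuous_on_compose2[OF cont[unfolded case_prod_unfold], of K
            "\<lambda>z. (fst z, snd (snd z))", simplified]) (auto simp: K_def intro!: continuous_intros)
    ultimately show ?thesis
      unfolding \<Phi>_def by (intro continuous_intros)
  qed
  ultimately obtain z where "z \<in> K" and z: "\<And>z'. z' \<in> K \<Longrightarrow> \<Phi> z' \<le> \<Phi> z"
    using continuous_attains_sup[of K \<Phi>] by blast
  then obtain X Y S where XYS: "a \<le> X" "X \<le> Y" "Y \<le> b" "S \<in> {0..T}" and zeq: "z = (X, Y, S)"
    by (cases z) (auto simp: K_def)
  have max: "v y' s - v x' s - (y' - x') - \<eta> * s \<le> v Y S - v X S - (Y - X) - \<eta> * S"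
    if "a \<le> x'" "x' \<le> y'" "y' \<le> b" "s \<in> {0..T}" for x' y' s
    using z[of "(x', y', s)"] that by (simp add: K_def \<Phi>_def zeq)
  have pos: "v Y S - v X S - (Y - X) - \<eta> * S > 0"
    using max[OF xyt] \<eta>(2) by linarith
  have "S \<noteq> 0"
    using pos init[OF XYS(1-3)] by auto
  then have S: "S \<in> {0<..T}"
    using XYS by auto
  have "X \<noteq> Y"
    using pos \<eta>(1) S by (auto simp: mult_less_0_iff)
  then have "X < Y"
    using XYS by auto
  obtain Dy where Dy: "((\<lambda>s. v Y s) has_real_derivative Dy) (at S within {0..T})" "Dy \<le> 0"
  proof (cases "Y = b")
    case True
    have "((\<lambda>s. v b s) has_real_derivative 0) (at S within {0..T})"
      by (rule has_field_derivative_transform_within[OF DERIV_const[of "v b 0"], of 1])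
        (use XYS(4) lateral(2)[symmetric] in auto)
    with True that show ?thesis by auto
  next
    case False
    then have Y: "Y \<in> {X<..<b}" "Y \<in> {a<..<b}"
      using XYS \<open>X < Y\<close> by auto
    from flux[OF Y(2) S] obtain D
      where D: "((\<lambda>y. Q y S) has_real_derivative D) (at Y)" "sgn D = sgn (vt Y S)" by auto
    have "D \<le> 0"
    proof (rule flux_derivative_at_max(2)[OF Y(1), where w = "\<lambda>y. v y S - y"
          and w' = "\<lambda>y. vx y S - 1" and Q = "\<lambda>y. Q y S"])
      fix y' assume y': "y' \<in> {X<..<b}"
      then have "y' \<in> {a<..<b}" using XYS by auto
      with S show "((\<lambda>y. v y S - y) has_real_derivative vx y' S - 1) (at y')"
        "sgn (Q y' S) = sgn (vx y' S - 1)"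
        by (auto intro!: derivative_eq_intros space sgn_flux)
      show "v y' S - y' \<le> v Y S - Y"
        using max[of X y' S] y' XYS by simp
    qed (rule D)
    then have "vt Y S \<le> 0"
      using D(2) by (auto simp: sgn_if split: if_splits)
    with time[OF Y(2) S] that show ?thesis by blast
  qed
  obtain Dx where Dx: "((\<lambda>s. v X s) has_real_derivative Dx) (at S within {0..T})" "Dx \<ge> 0"
  proof (cases "X = a")
    case True
    have "((\<lambda>s. v a s) has_real_derivative 0) (at S within {0..T})"
      by (rule has_field_derivative_transform_within[OF DERIV_const[of "v a 0"], of 1])
        (use XYS(4) lateral(1)[symmetric] in auto)
    with True that show ?thesis by auto
  next
    case False
    then have X: "X \<in> {a<..<Y}" "X \<in> {a<..<b}"
      using XYS \<open>X < Y\<close> by auto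
    from flux[OF X(2) S] obtain D
      where D: "((\<lambda>y. Q y S) has_real_derivative D) (at X)" "sgn D = sgn (vt X S)" by auto
    have "- D \<le> 0"
    proof (rule flux_derivative_at_max(2)[OF X(1), where w = "\<lambda>y. y - v y S"
          and w' = "\<lambda>y. 1 - vx y S" and Q = "\<lambda>y. - Q y S"])
      fix y' assume y': "y' \<in> {a<..<Y}"
      then have "y' \<in> {a<..<b}" using XYS by auto
      with S show "((\<lambda>y. y - v y S) has_real_derivative 1 - vx y' S) (at y')"
        "sgn (- Q y' S) = sgn (1 - vx y' S)"
        using sgn_flux[of y' S] sgn_minus[of "vx y' S - 1"]
        by (auto intro!: derivative_eq_intros space simp: sgn_minus)
      show "y' - v y' S \<le> X - v X S"
        using max[of y' Y S] y' XYS by simp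
    qed (use D(1) in \<open>auto intro!: derivative_eq_intros\<close>)
    then have "vt X S \<ge> 0"
      using D(2) by (auto simp: sgn_if split: if_splits)
    with time[OF X(2) S] that show ?thesis by blast
  qed
  have "Dy - Dx - \<eta> \<ge> 0"
  proof (rule time_derivative_at_max[OF _ S])
    show "((\<lambda>s. v Y s - v X s - \<eta> * s) has_real_derivative Dy - Dx - \<eta>) (at S within {0..T})"
      using Dy(1) Dx(1) by (auto intro!: derivative_eq_intros)
    show "v Y s - v X s - \<eta> * s \<le> v Y S - v X S - \<eta> * S" if "s \<in> {0..T}" for s
      using max[of X Y s] XYS that by simp
  qed
  then show False
    using Dy(2) Dx(2) \<eta>(1) by simp
qed

section \<open>Subcritical solutions\<close>

text \<open>
  Solutions of \<open>u\<^sub>t = (F(p) - f(u))\<^sub>x\<close>, \<open>p = u\<^sub>x\<close>, with \<open>\<bar>p\<bar> < 1/\<epsilon>\<close> and stationary boundary values.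
  The derivatives \<open>p\<close> and \<open>ut\<close> are parameters so that the reflection \<open>u \<mapsto> -u\<close>
  is an interpretation.
\<close>

locale subcritical_solution =
  fixes l \<epsilon> T :: real and f :: "real \<Rightarrow> real" and u p ut :: "real \<Rightarrow> real \<Rightarrow> real"
  assumes l_pos: "l > 0" and eps_pos: "\<epsilon> > 0" and T_pos: "T > 0"
    and f_diff: "\<And>s. f field_differentiable (at s)"
    and u_cont: "continuous_on ({-l..l} \<times> {0..T}) (\<lambda>(x, t). u x t)"
    and lateral: "\<And>t. t \<in> {0..T} \<Longrightarrow> u (-l) t = u (-l) 0" "\<And>t. t \<in> {0..T} \<Longrightarrow> u l t = u l 0"
    and time: "\<And>x t. x \<in> {-l<..<l} \<Longrightarrow> t \<in> {0<..T} \<Longrightarrow>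
        ((\<lambda>s. u x s) has_real_derivative ut x t) (at t within {0..T})"
    and space: "\<And>x t. x \<in> {-l<..<l} \<Longrightarrow> t \<in> {0<..T} \<Longrightarrow>
        ((\<lambda>y. u y t) has_real_derivative p x t) (at x)"
    and subcritical: "\<And>x t. x \<in> {-l<..<l} \<Longrightarrow> t \<in> {0<..T} \<Longrightarrow> \<bar>p x t\<bar> < inverse \<epsilon>"
    and flux: "\<And>x t. x \<in> {-l<..<l} \<Longrightarrow> t \<in> {0<..T} \<Longrightarrow>
        ((\<lambda>y. mc_flux \<epsilon> (p y t) - f (u y t)) has_real_derivative ut x t) (at x)"
begin

lemma minus: "subcritical_solution l \<epsilon> T (\<lambda>s. - f (- s))
    (\<lambda>x t. - u x t) (\<lambda>x t. - p x t) (\<lambda>x t. - ut x t)"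
proof
  show "(\<lambda>s. - f (- s)) field_differentiable (at s)" for s
  proof -
    obtain D where "(f has_real_derivative D) (at (- s))"
      using f_diff[of "- s"] by (auto simp: field_differentiable_def)
    then have "((\<lambda>s. - f (- s)) has_real_derivative D) (at s)"
      by (auto intro!: derivative_eq_intros DERIV_chain2[of f D])
    then show ?thesis
      by (auto simp: field_differentiable_def)
  qed
  show "continuous_on ({-l..l} \<times> {0..T}) (\<lambda>(x, t). - u x t)"
    using continuous_on_minus[OF u_cont] by (simp add: case_prod_unfold)
  show "((\<lambda>y. mc_flux \<epsilon> (- p y t) - (- f (- (- u y t)))) has_real_derivative - ut x t) (at x)"
    if "x \<in> {-l<..<l}" "t \<in> {0<..T}" for x t
    using DERIV_minus[OF flux[OF that]] by (simp add: mc_flux_minus)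
  show "- u (-l) t = - u (-l) 0" "- u l t = - u l 0" if "t \<in> {0..T}" for t
    using lateral[OF that] by simp_all
qed (use l_pos eps_pos T_pos subcritical in
      \<open>simp_all add: DERIV_minus[OF time] DERIV_minus[OF space]\<close>)

text \<open>
  At an interior maximum of \<open>u - \<eta> t\<close> in space and time, \<open>p = 0\<close>; so the convective term
  \<open>f'(u) p\<close> vanishes, \<open>F(p)\<close> itself has derivative \<open>ut\<close>, and it has the sign of \<open>p\<close>.
\<close>

theorem upper_bound:
  assumes init: "\<And>x. x \<in> {-l..l} \<Longrightarrow> u x 0 \<le> M"
    and xt: "x \<in> {-l..l}" "t \<in> {0..T}"
  shows "u x t \<le> M"
proof (rule ccontr)
  assume "\<not> u x t \<le> M"
  then have viol: "u x t - M > 0" by simp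
  define \<eta> where "\<eta> = (u x t - M) / (T + 1)"
  have \<eta>: "\<eta> > 0" "u x t - \<eta> * t > M"
  proof -
    have "T + 1 > 0" "T + 1 - t > 0"
      using xt T_pos by auto
    then show "\<eta> > 0"
      using viol by (simp add: \<eta>_def)
    moreover have "u x t - M = \<eta> * (T + 1)"
      using \<open>T + 1 > 0\<close> by (simp add: \<eta>_def)
    ultimately show "u x t - \<eta> * t > M"
      using mult_pos_pos[OF \<open>\<eta> > 0\<close> \<open>T + 1 - t > 0\<close>] by (simp add: algebra_simps)
  qed
  define \<Phi> where "\<Phi> = (\<lambda>z. u (fst z) (snd z) - \<eta> * snd z)"
  have "continuous_on ({-l..l} \<times> {0..T}) \<Phi>"
    using u_cont unfolding \<Phi>_def by (auto simp: case_prod_unfold intro!: continuous_intros)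
  moreover have "compact ({-l..l} \<times> {0..T})"
    by (intro compact_Times) auto
  moreover have "{-l..l} \<times> {0..T} \<noteq> {}"
    using xt by auto
  ultimately obtain z where "z \<in> {-l..l} \<times> {0..T}"
    and z: "\<And>z'. z' \<in> {-l..l} \<times> {0..T} \<Longrightarrow> \<Phi> z' \<le> \<Phi> z"
    using continuous_attains_sup[of "{-l..l} \<times> {0..T}" \<Phi>] by blast
  then obtain X S where XS: "X \<in> {-l..l}" "S \<in> {0..T}" and zeq: "z = (X, S)"
    by auto
  have max: "u y s - \<eta> * s \<le> u X S - \<eta> * S" if "y \<in> {-l..l}" "s \<in> {0..T}" for y s
    using z[of "(y, s)"] that by (simp add: \<Phi>_def zeq)
  have pos: "u X S - \<eta> * S > M"
    using max[OF xt] \<eta>(2) by linarith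
  have "\<eta> * S \<ge> 0"
    using \<eta>(1) XS by auto
  have "u X S \<noteq> u X 0"
    using init[OF XS(1)] pos \<open>\<eta> * S \<ge> 0\<close> by auto
  then have X: "X \<in> {-l<..<l}" and S: "S \<in> {0<..T}"
    using XS lateral[OF XS(2)] by (auto simp: less_le)
  obtain f' where f': "(f has_real_derivative f') (at (u X S))"
    using f_diff by (auto simp: field_differentiable_def)
  have dF: "((\<lambda>y. mc_flux \<epsilon> (p y S)) has_real_derivative ut X S + f' * p X S) (at X)"
    using DERIV_add[OF flux[OF X S] DERIV_chain2[OF f' space[OF X S]]] by simp
  have sgn_F: "sgn (mc_flux \<epsilon> (p y S)) = sgn (p y S)" if "y \<in> {-l<..<l}" for y
    using sgn_mc_flux_diff[OF eps_pos subcritical[OF that S], of 0] by (simp add: mc_slope_def)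
  have umax: "u y S \<le> u X S" if "y \<in> {-l<..<l}" for y
    using max[of y S] that XS by auto
  have "p X S = 0" "ut X S + f' * p X S \<le> 0"
    using flux_derivative_at_max[OF X space[OF _ S] sgn_F dF umax] by auto
  moreover have "ut X S - \<eta> \<ge> 0"
  proof (rule time_derivative_at_max[OF _ S])
    show "((\<lambda>s. u X s - \<eta> * s) has_real_derivative ut X S - \<eta>) (at S within {0..T})"
      using time[OF X S] by (auto intro!: derivative_eq_intros)
    show "u X s - \<eta> * s \<le> u X S - \<eta> * S" if "s \<in> {0..T}" for s
      using max[of X s] XS that by simp
  qed
  ultimately show False
    using \<eta>(1) by simp
qed

text \<open>
  The two-point principle is applied to \<open>v = \<phi>(u)\<close> with \<open>\<phi>' = 1 / G(f + c)\<close> and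
  \<open>Q = F(p) - f(u) - c\<close>: the slope \<open>v\<^sub>x = p / G(f(u) + c)\<close> exceeds one exactly where \<open>Q > 0\<close>.
\<close>

theorem lipschitz_upper_bound:
  assumes K: "0 < K" "K < inverse \<epsilon>"
    and init: "\<And>x y. -l \<le> x \<Longrightarrow> x \<le> y \<Longrightarrow> y \<le> l \<Longrightarrow> u y 0 - u x 0 \<le> K * (y - x)"
  obtains L where "0 < L" "L < inverse \<epsilon>"
    "\<And>x y t. -l \<le> x \<Longrightarrow> x \<le> y \<Longrightarrow> y \<le> l \<Longrightarrow> t \<in> {0..T} \<Longrightarrow> u y t - u x t \<le> L * (y - x)"
proof -
  have "compact ((\<lambda>(x, t). u x t) ` ({-l..l} \<times> {0..T}))"
    using u_cont by (intro compact_continuous_image compact_Times) auto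
  then obtain R where "\<forall>s \<in> (\<lambda>(x, t). u x t) ` ({-l..l} \<times> {0..T}). norm s \<le> R"
    using compact_imp_bounded bounded_iff by metis
  then have R: "\<bar>u x t\<bar> \<le> R" if "x \<in> {-l..l}" "t \<in> {0..T}" for x t
    using that by force
  \<comment> \<open>A margin around the range of \<open>u\<close>, so that \<open>\<phi>\<close> has two-sided derivatives on the range.\<close>
  define J where "J = {- R - 1..R + 1}"
  have f_cont: "continuous_on A f" for A
    using f_diff by (intro continuous_at_imp_continuous_on ballI field_differentiable_imp_continuous_at)
  then have "compact (f ` J)"
    unfolding J_def by (intro compact_continuous_image) auto
  then obtain M where "\<forall>s \<in> f ` J. norm s \<le> M"
    using compact_imp_bounded bounded_iff by metis
  then have M: "\<bar>f s\<bar> \<le> M" if "s \<in> J" for s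
    using that by force
  \<comment> \<open>With this \<open>c\<close> the comparison slope \<open>G(f + c)\<close> is at least \<open>K\<close>, which settles the initial time.\<close>
  define c where "c = mc_flux \<epsilon> K + M"
  define P where "P = (\<lambda>s. mc_slope \<epsilon> (f s + c))"
  define L where "L = mc_slope \<epsilon> (M + c)"
  have absK: "\<bar>K\<bar> < inverse \<epsilon>"
    using K by simp
  have P: "K \<le> P s" "P s \<le> L" "P s > 0" if "s \<in> J" for s
  proof -
    show "K \<le> P s"
      using M[OF that] unfolding P_def c_def by (simp add: mc_slope_le_iff[OF eps_pos absK])
    then show "P s > 0" using K by simp
    show "P s \<le> L"
      using M[OF that] unfolding P_def L_def by (intro mc_slope_mono eps_pos) simp
  qed
  have "continuous_on J P"
    unfolding P_def by (intro continuous_on_mc_slope eps_pos continuous_on_add f_cont continuous_on_const)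
  moreover have "\<forall>s\<in>J. P s \<noteq> 0"
    using P(3) by (blast dest: less_imp_neq[symmetric])
  ultimately have "continuous_on J (\<lambda>s. 1 / P s)"
    by (intro continuous_on_divide continuous_on_const)
  then obtain \<phi> where \<phi>: "\<And>s. s \<in> J \<Longrightarrow> (\<phi> has_vector_derivative 1 / P s) (at s within J)"
    unfolding J_def using antiderivative_continuous by blast
  have d\<phi>: "(\<phi> has_real_derivative 1 / P s) (at s)" if "\<bar>s\<bar> \<le> R" for s
  proof -
    have J: "s \<in> interior J" "s \<in> J"
      using that by (auto simp: J_def)
    show ?thesis
      using \<phi>[OF J(2)]
      by (simp only: at_within_interior[OF J(1)] has_real_derivative_iff_has_vector_derivative)
  qed
  have \<phi>_bounds: "(s2 - s1) / L \<le> \<phi> s2 - \<phi> s1" "\<phi> s2 - \<phi> s1 \<le> (s2 - s1) / K"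
    if "\<bar>s1\<bar> \<le> R" "\<bar>s2\<bar> \<le> R" "s1 < s2" for s1 s2
  proof -
    obtain s where s: "s1 < s" "s < s2" and eq: "\<phi> s2 - \<phi> s1 = (s2 - s1) * (1 / P s)"
    proof -
      have "(\<phi> has_real_derivative 1 / P s) (at s)" if "s1 \<le> s" "s \<le> s2" for s
        using d\<phi>[of s] that \<open>\<bar>s1\<bar> \<le> R\<close> \<open>\<bar>s2\<bar> \<le> R\<close> by linarith
      then show thesis
        using MVT2[OF \<open>s1 < s2\<close>, of \<phi> "\<lambda>s. 1 / P s"] that by blast
    qed
    have "s \<in> J"
      using s that by (auto simp: J_def)
    note Ps = P[OF this]
    show "(s2 - s1) / L \<le> \<phi> s2 - \<phi> s1"
      unfolding eq using Ps K that by (simp add: divide_left_mono)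
    show "\<phi> s2 - \<phi> s1 \<le> (s2 - s1) / K"
      unfolding eq using Ps K that by (simp add: divide_left_mono)
  qed
  have inJ: "u x t \<in> J" if "x \<in> {-l..l}" "t \<in> {0..T}" for x t
    using R[OF that] by (auto simp: J_def)
  have "0 \<in> J" using R[of 0 0] l_pos T_pos by (auto simp: J_def)
  have "0 < L" "L < inverse \<epsilon>"
    using P[OF \<open>0 \<in> J\<close>] abs_mc_slope[OF eps_pos, of "M + c"] by (auto simp: L_def)
  moreover have "u y t - u x t \<le> L * (y - x)"
    if xyt: "-l \<le> x" "x \<le> y" "y \<le> l" "t \<in> {0..T}" for x y t
  proof -
    have "\<phi> (u y t) - \<phi> (u x t) \<le> y - x"
    proof (rule two_point_maximum_principle[where v = "\<lambda>x t. \<phi> (u x t)" and a = "-l" and b = l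
          and T = T and vx = "\<lambda>x t. p x t / P (u x t)" and vt = "\<lambda>x t. ut x t / P (u x t)"
          and Q = "\<lambda>x t. mc_flux \<epsilon> (p x t) - f (u x t) - c"])
      have "continuous_on {-R..R} \<phi>"
        by (intro continuous_at_imp_continuous_on ballI DERIV_isCont[OF d\<phi>]) auto
      then have "continuous_on ({-l..l} \<times> {0..T}) (\<lambda>z. \<phi> ((\<lambda>(x, t). u x t) z))"
        by (rule continuous_on_compose2[OF _ u_cont]) (use R in \<open>force simp: abs_le_iff\<close>)
      then show "continuous_on ({-l..l} \<times> {0..T}) (\<lambda>(x, t). \<phi> (u x t))"
        by (simp add: case_prod_unfold)
    next
      fix x t assume xt: "x \<in> {-l<..<l}" "t \<in> {0<..T}"
      then have xt': "x \<in> {-l..l}" "t \<in> {0..T}" by auto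
      note Pu = P(3)[OF inJ[OF xt']]
      show "((\<lambda>s. \<phi> (u x s)) has_real_derivative ut x t / P (u x t)) (at t within {0..T})"
        using DERIV_chain2[OF d\<phi>[OF R[OF xt']] time[OF xt]] by simp
      show "((\<lambda>y. \<phi> (u y t)) has_real_derivative p x t / P (u x t)) (at x)"
        using DERIV_chain2[OF d\<phi>[OF R[OF xt']] space[OF xt]] by simp
      have "sgn (mc_flux \<epsilon> (p x t) - (f (u x t) + c)) = sgn (p x t - P (u x t))"
        unfolding P_def by (rule sgn_mc_flux_diff[OF eps_pos subcritical[OF xt]])
      also have "\<dots> = sgn ((p x t - P (u x t)) / P (u x t))"
        using Pu by (simp add: sgn_divide)
      finally show "sgn (mc_flux \<epsilon> (p x t) - f (u x t) - c) = sgn (p x t / P (u x t) - 1)"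
        using Pu by (simp add: diff_divide_distrib algebra_simps)
      have "((\<lambda>y. mc_flux \<epsilon> (p y t) - f (u y t) - c) has_real_derivative ut x t) (at x)"
        using DERIV_diff[OF flux[OF xt] DERIV_const[of c]] by simp
      moreover have "sgn (ut x t) = sgn (ut x t / P (u x t))"
        using Pu by (simp add: sgn_divide)
      ultimately show "\<exists>D. ((\<lambda>y. mc_flux \<epsilon> (p y t) - f (u y t) - c) has_real_derivative D) (at x)
          \<and> sgn D = sgn (ut x t / P (u x t))"
        by blast
    next
      show "\<phi> (u (-l) t) = \<phi> (u (-l) 0)" "\<phi> (u l t) = \<phi> (u l 0)" if "t \<in> {0..T}" for t
        using lateral[OF that] by simp_all
    next
      fix x y assume xy: "-l \<le> x" "x \<le> y" "y \<le> l"
      then have bd: "\<bar>u x 0\<bar> \<le> R" "\<bar>u y 0\<bar> \<le> R"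
        using R T_pos by auto
      consider "u x 0 < u y 0" | "u x 0 = u y 0" | "u y 0 < u x 0" by linarith
      then show "\<phi> (u y 0) - \<phi> (u x 0) \<le> y - x"
      proof cases
        case 1
        then have "\<phi> (u y 0) - \<phi> (u x 0) \<le> (u y 0 - u x 0) / K"
          using \<phi>_bounds(2)[OF bd] by simp
        also have "\<dots> \<le> y - x"
          using init[OF xy] K by (simp add: divide_le_eq mult.commute)
        finally show ?thesis .
      next
        case 3
        have "0 \<le> (u x 0 - u y 0) / L"
          using 3 \<open>0 < L\<close> by simp
        also have "\<dots> \<le> \<phi> (u x 0) - \<phi> (u y 0)"
          using \<phi>_bounds(1)[OF bd(2,1) 3] .
        finally show ?thesis
          using xy by simp
      qed (use xy in simp)
    qed (fact xyt)+
    moreover have "(u y t - u x t) / L \<le> \<phi> (u y t) - \<phi> (u x t)" if "u x t < u y t"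
      using \<phi>_bounds(1)[OF R R that] xyt by simp
    ultimately have "(u y t - u x t) / L \<le> y - x" if "u x t < u y t"
      using that by linarith
    then show ?thesis
      using \<open>0 < L\<close> xyt by (cases "u x t < u y t") (auto simp: divide_le_eq mult.commute
          intro: order_trans[of _ 0])
  qed
  ultimately show thesis
    using that by blast
qed

corollary abs_bound:
  assumes init: "\<And>x. x \<in> {-l..l} \<Longrightarrow> \<bar>u x 0\<bar> \<le> M"
    and xt: "x \<in> {-l..l}" "t \<in> {0..T}"
  shows "\<bar>u x t\<bar> \<le> M"
proof -
  interpret neg: subcritical_solution l \<epsilon> T "\<lambda>s. - f (- s)"
    "\<lambda>x t. - u x t" "\<lambda>x t. - p x t" "\<lambda>x t. - ut x t" by (rule minus)
  have "u x t \<le> M"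
    by (rule upper_bound[OF _ xt]) (use init in \<open>auto simp: abs_le_iff\<close>)
  moreover have "- u x t \<le> M"
    by (rule neg.upper_bound[OF _ xt]) (use init in \<open>auto simp: abs_le_iff\<close>)
  ultimately show ?thesis by simp
qed

corollary lipschitz_bound:
  assumes K: "0 < K" "K < inverse \<epsilon>"
    and init: "\<And>x y. -l \<le> x \<Longrightarrow> x \<le> y \<Longrightarrow> y \<le> l \<Longrightarrow> \<bar>u y 0 - u x 0\<bar> \<le> K * (y - x)"
  obtains L where "L < inverse \<epsilon>"
    "\<And>x y t. -l \<le> x \<Longrightarrow> x \<le> y \<Longrightarrow> y \<le> l \<Longrightarrow> t \<in> {0..T} \<Longrightarrow> \<bar>u y t - u x t\<bar> \<le> L * (y - x)"
proof -
  interpret neg: subcritical_solution l \<epsilon> T "\<lambda>s. - f (- s)"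
    "\<lambda>x t. - u x t" "\<lambda>x t. - p x t" "\<lambda>x t. - ut x t" by (rule minus)
  obtain L1 where L1: "L1 < inverse \<epsilon>" "\<And>x y t. -l \<le> x \<Longrightarrow> x \<le> y \<Longrightarrow> y \<le> l \<Longrightarrow> t \<in> {0..T}
      \<Longrightarrow> u y t - u x t \<le> L1 * (y - x)"
    using lipschitz_upper_bound[OF K] init by (metis abs_le_D1)
  have "- u y 0 - - u x 0 \<le> K * (y - x)" if "-l \<le> x" "x \<le> y" "y \<le> l" for x y
    using init[OF that] by simp
  then obtain L2 where L2: "L2 < inverse \<epsilon>" "\<And>x y t. -l \<le> x \<Longrightarrow> x \<le> y \<Longrightarrow> y \<le> l \<Longrightarrow> t \<in> {0..T}
      \<Longrightarrow> - u y t - - u x t \<le> L2 * (y - x)"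
    using neg.lipschitz_upper_bound[OF K] by metis
  have "\<bar>u y t - u x t\<bar> \<le> max L1 L2 * (y - x)"
    if "-l \<le> x" "x \<le> y" "y \<le> l" "t \<in> {0..T}" for x y t
  proof -
    have "L1 * (y - x) \<le> max L1 L2 * (y - x)" "L2 * (y - x) \<le> max L1 L2 * (y - x)"
      using that by (auto intro!: mult_right_mono)
    then show ?thesis
      using L1(2)[OF that] L2(2)[OF that] by linarith
  qed
  then show thesis
    using that[of "max L1 L2"] L1(1) L2(1) by auto
qed

end

section \<open>Essential suprema of continuous functions\<close>

text \<open>
  By continuity, a value above the essential supremum would force larger values on a whole nonempty
  open set, which has positive measure.
\<close>

lemma abs_le_Linf_norm:
  assumes "open S" "continuous_on S g" "x \<in> S"
  shows "ereal \<bar>g x\<bar> \<le> Linf_norm S g"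
proof (rule ccontr)
  assume "\<not> ?thesis"
  then have "Linf_norm S g < ereal \<bar>g x\<bar>" by (simp only: not_le)
  then obtain r where r: "Linf_norm S g < ereal r" "r < \<bar>g x\<bar>"
    using ereal_dense2[of "Linf_norm S g" "ereal \<bar>g x\<bar>"] by auto
  define A where "A = S \<inter> (\<lambda>x. \<bar>g x\<bar>) -` {r<..}"
  have "open A"
    unfolding A_def using assms by (intro continuous_open_preimage continuous_intros) auto
  have "AE y in lebesgue_on S. ereal \<bar>g y\<bar> \<le> Linf_norm S g"
    unfolding Linf_norm_def by (rule esssup_AE)
  then have "AE y in lebesgue. y \<in> S \<longrightarrow> ereal \<bar>g y\<bar> \<le> Linf_norm S g"
    using assms(1) by (subst (asm) AE_restrict_space_iff) auto
  then have "AE y in lebesgue. y \<notin> A"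
  proof eventually_elim
    case (elim y)
    then show ?case
      using r by (auto simp: A_def dest: order.strict_trans1)
  qed
  then have "A \<in> null_sets lebesgue"
    using \<open>open A\<close> by (subst AE_iff_null_sets) auto
  moreover have "x \<in> A"
    using assms r by (simp add: A_def)
  ultimately show False
    using open_not_negligible[OF \<open>open A\<close>] by (auto simp: negligible_iff_null_sets)
qed

lemma Linf_norm_le:
  assumes "open S" "continuous_on S g" "\<And>x. x \<in> S \<Longrightarrow> ereal \<bar>g x\<bar> \<le> N"
  shows "Linf_norm S g \<le> N"
  unfolding Linf_norm_def
proof (rule esssup_I)
  have "(\<lambda>x. \<bar>g x\<bar>) \<in> borel_measurable (lebesgue_on S)"
    using assms(1,2) by (intro continuous_imp_measurable_on_sets_lebesgue continuous_intros) auto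
  then show "(\<lambda>x. ereal \<bar>g x\<bar>) \<in> borel_measurable (lebesgue_on S)"
    by measurable
  show "AE x in lebesgue_on S. ereal \<bar>g x\<bar> \<le> N"
    using assms(3) by (intro AE_I2) (simp add: space_restrict_space)
qed

section \<open>Classical solutions\<close>

lemma Ck_on_has_derivative:
  assumes "Ck_on k S g" "0 < k" "x \<in> S"
  shows "(g has_real_derivative deriv g x) (at x)"
proof -
  have "(deriv ^^ 0) g field_differentiable (at x)"
    using assms unfolding Ck_on_def by blast
  then show ?thesis
    by (simp add: DERIV_deriv_iff_field_differentiable)
qed

lemma Ck_on_continuous_deriv:
  assumes "Ck_on k S g" "1 < k"
  shows "continuous_on S (deriv g)"
proof (rule continuous_at_imp_continuous_on, rule ballI)
  fix x assume "x \<in> S"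
  then have "(deriv ^^ 1) g field_differentiable (at x)"
    using assms unfolding Ck_on_def by blast
  then have "deriv g field_differentiable (at x)"
    by simp
  then show "isCont (deriv g) x"
    by (rule field_differentiable_imp_continuous_at)
qed

lemma lipschitz_of_derivative_bound:
  fixes g :: "real \<Rightarrow> real"
  assumes "continuous_on {a..b} g" "\<And>x. x \<in> {a<..<b} \<Longrightarrow> (g has_real_derivative g' x) (at x)"
    and "\<And>x. x \<in> {a<..<b} \<Longrightarrow> \<bar>g' x\<bar> \<le> K" and xy: "a \<le> x" "x \<le> y" "y \<le> b"
  shows "\<bar>g y - g x\<bar> \<le> K * (y - x)"
proof (cases "x = y")
  case False
  then have "x < y" using xy by simp
  have "continuous_on {x..y} g"
    using xy by (intro continuous_on_subset[OF assms(1)]) auto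
  moreover have "g differentiable (at z)" if "x < z" "z < y" for z
    using assms(2)[of z] that xy by (auto simp: real_differentiable_def)
  ultimately obtain D z where z: "x < z" "z < y" "(g has_real_derivative D) (at z)"
    and eq: "g y - g x = (y - x) * D"
    using MVT[OF \<open>x < y\<close>] by blast
  have "D = g' z"
    using DERIV_unique[OF z(3) assms(2)] z xy by simp
  then have "\<bar>D\<bar> \<le> K"
    using assms(3)[of z] z xy by simp
  then show ?thesis
    using \<open>x < y\<close> by (simp add: eq abs_mult mult.commute)
qed simp

lemma derivative_bound_of_lipschitz:
  fixes g :: "real \<Rightarrow> real"
  assumes "\<And>x y. a < x \<Longrightarrow> x \<le> y \<Longrightarrow> y < b \<Longrightarrow> \<bar>g y - g x\<bar> \<le> L * (y - x)"
    and D: "(g has_real_derivative D) (at x)" and x: "x \<in> {a<..<b}"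
  shows "\<bar>D\<bar> \<le> L"
proof -
  have "mono_on {a<..<b} (\<lambda>y. L * y - g y)" "mono_on {a<..<b} (\<lambda>y. L * y + g y)"
    using assms(1) by (force simp: mono_on_def abs_le_iff right_diff_distrib)+
  moreover have "((\<lambda>y. L * y - g y) has_real_derivative L - D) (at x)"
    "((\<lambda>y. L * y + g y) has_real_derivative L + D) (at x)"
    using D by (auto intro!: derivative_eq_intros)
  moreover have "x \<in> interior {a<..<b}"
    using x by simp
  ultimately have "0 \<le> L - D" "0 \<le> L + D"
    by (blast intro: mono_on_imp_deriv_nonneg)+
  then show ?thesis by simp
qed

text \<open>
  Subcriticality comes from the initial datum only through the boundary values: it gives
  \<open>\<bar>u(l) - u(-l)\<bar> \<le> 2 K l\<close>, which persists, so that at each time the mean value theorem yields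
  a point where \<open>\<bar>u\<^sub>x\<bar> \<le> K\<close>, from where the bound spreads over the interval.
\<close>

lemma classical_solution_subcritical:
  assumes pos: "l > 0" "\<epsilon> > 0" "T > 0"
    and f: "Ck_on k UNIV f" "0 < k"
    and sol: "classical_solution l \<epsilon> f um up u0 T u"
    and K: "K < inverse \<epsilon>" "\<bar>u l 0 - u (-l) 0\<bar> \<le> K * (2 * l)"
  obtains ut where "subcritical_solution l \<epsilon> T f u (u_x u) ut"
proof -
  from sol obtain ut where
    cont: "continuous_on ({-l..l} \<times> {0..T}) (\<lambda>(x, t). u x t)"
    and C2: "\<And>t. t \<in> {0<..T} \<Longrightarrow> Ck_on 2 {-l<..<l} (\<lambda>x. u x t)"
    and time: "\<And>x t. x \<in> {-l<..<l} \<Longrightarrow> t \<in> {0<..T} \<Longrightarrow>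
      ((\<lambda>s. u x s) has_real_derivative ut x t) (at t within {0..T})"
    and flux: "\<And>x t. x \<in> {-l<..<l} \<Longrightarrow> t \<in> {0<..T} \<Longrightarrow>
      ((\<lambda>y. mc_flux \<epsilon> (u_x u y t)) has_real_derivative (ut x t + deriv (\<lambda>y. f (u y t)) x)) (at x)"
    and bd: "\<And>t. t \<in> {0..T} \<Longrightarrow> u (-l) t = um" "\<And>t. t \<in> {0..T} \<Longrightarrow> u l t = up"
    unfolding classical_solution_def by blast
  have f_diff: "(f has_real_derivative deriv f s) (at s)" for s
    using Ck_on_has_derivative[OF f] by simp
  have space: "((\<lambda>y. u y t) has_real_derivative u_x u x t) (at x)"
    if "x \<in> {-l<..<l}" "t \<in> {0<..T}" for x t
    unfolding u_x_def using Ck_on_has_derivative[OF C2[OF that(2)] _ that(1)] by simp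
  have subcritical: "\<bar>u_x u x t\<bar> < inverse \<epsilon>" if x: "x \<in> {-l<..<l}" and t: "t \<in> {0<..T}" for x t
  proof -
    have "continuous_on {-l..l} (\<lambda>y. (\<lambda>(x, t). u x t) (y, t))"
      using t by (intro continuous_on_compose2[OF cont] continuous_intros) auto
    then have "continuous_on {-l..l} (\<lambda>y. u y t)" by simp
    moreover have "(\<lambda>y. u y t) differentiable (at z)" if "-l < z" "z < l" for z
      using space[OF _ t, of z] that by (auto simp: real_differentiable_def)
    moreover have "-l < l" using pos by simp
    ultimately obtain D \<xi> where \<xi>: "\<xi> \<in> {-l<..<l}" "((\<lambda>y. u y t) has_real_derivative D) (at \<xi>)"
      and eq: "u l t - u (-l) t = (l - -l) * D"
      using MVT[of "-l" l "\<lambda>y. u y t"] by (metis greaterThanLessThan_iff)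
    have "\<bar>u l t - u (-l) t\<bar> = \<bar>u l 0 - u (-l) 0\<bar>"
      using t pos by (simp add: bd)
    then have "2 * l * \<bar>D\<bar> \<le> K * (2 * l)"
      using K(2) pos unfolding eq by (simp add: abs_mult)
    then have "\<bar>D\<bar> < inverse \<epsilon>"
      using pos K(1) by (simp add: mult.commute)
    moreover have "u_x u \<xi> t = D"
      using DERIV_unique[OF space[OF \<xi>(1) t] \<xi>(2)] .
    moreover have "continuous_on {-l<..<l} (\<lambda>y. u_x u y t)"
      unfolding u_x_def by (rule Ck_on_continuous_deriv[OF C2[OF t]]) simp
    moreover have "continuous_on {-l<..<l} (\<lambda>y. mc_flux \<epsilon> (u_x u y t))"
      using flux[OF _ t] by (blast intro: continuous_at_imp_continuous_on DERIV_isCont)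
    ultimately show ?thesis
      using subcritical_on_connected[OF pos(2) _ _ _ \<xi>(1) _ x, of "\<lambda>y. u_x u y t"] by simp
  qed
  have "subcritical_solution l \<epsilon> T f u (u_x u) ut"
  proof
    show "f field_differentiable (at s)" for s
      using f_diff by (auto simp: field_differentiable_def)
    show "((\<lambda>y. mc_flux \<epsilon> (u_x u y t) - f (u y t)) has_real_derivative ut x t) (at x)"
      if "x \<in> {-l<..<l}" "t \<in> {0<..T}" for x t
    proof -
      note df = DERIV_chain2[OF f_diff space[OF that]]
      show ?thesis
        using DERIV_diff[OF flux[OF that] df] DERIV_imp_deriv[OF df] by simp
    qed
  qed (use pos cont time space subcritical bd in auto)
  then show thesis by (rule that)
qed

theorem proposition3p8:
  fixes l \<epsilon> T um up :: real
    and f u0 :: "real \<Rightarrow> real"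
    and u :: "real \<Rightarrow> real \<Rightarrow> real"
  assumes "l > 0" and "\<epsilon> > 0" and "T > 0"
    and "Ck_on 2 UNIV f"
    and "classical_solution l \<epsilon> f um up u0 T u"
    and "\<forall>t\<in>{0..T}. Ck_on 3 {-l<..<l} (\<lambda>x. u x t)"
    and "Linf_norm {-l<..<l} (deriv u0) < ereal (inverse \<epsilon>)"
  shows "\<forall>t\<in>{0..T}.
      Linf_norm {-l<..<l} (\<lambda>x. u x t) \<le> Linf_norm {-l<..<l} u0 \<and>
      Linf_norm {-l<..<l} (\<lambda>x. u_x u x t) < ereal (inverse \<epsilon>)"
proof -
  have cont: "continuous_on ({-l..l} \<times> {0..T}) (\<lambda>(x, t). u x t)"
    and u0: "\<And>x. x \<in> {-l<..<l} \<Longrightarrow> u x 0 = u0 x"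
    using assms(5) unfolding classical_solution_def by blast+
  have cont_t: "continuous_on {-l..l} (\<lambda>y. u y t)" if "t \<in> {0..T}" for t
  proof -
    have "continuous_on {-l..l} (\<lambda>y. (\<lambda>(x, t). u x t) (y, t))"
      using that by (intro continuous_on_compose2[OF cont] continuous_intros) auto
    then show ?thesis by simp
  qed
  have cont_open: "continuous_on {-l<..<l} (\<lambda>y. u y t)" if "t \<in> {0..T}" for t
    by (rule continuous_on_subset[OF cont_t[OF that]]) auto
  have C3: "Ck_on 3 {-l<..<l} (\<lambda>x. u x t)" if "t \<in> {0..T}" for t
    using assms(6) that by blast
  have du: "((\<lambda>y. u y t) has_real_derivative u_x u x t) (at x)"
    if "x \<in> {-l<..<l}" "t \<in> {0..T}" for x t
    unfolding u_x_def using Ck_on_has_derivative[OF C3[OF that(2)] _ that(1)] by simp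
  have ux_cont: "continuous_on {-l<..<l} (\<lambda>x. u_x u x t)" if "t \<in> {0..T}" for t
    unfolding u_x_def by (rule Ck_on_continuous_deriv[OF C3[OF that]]) simp
  have t0: "0 \<in> {0..T}" using assms(3) by simp
  have du0: "deriv u0 x = u_x u x 0" if "x \<in> {-l<..<l}" for x
  proof -
    have "\<forall>\<^sub>F y in nhds x. y \<in> {-l<..<l}"
      using that by (intro eventually_nhds_in_open) auto
    then have "\<forall>\<^sub>F y in nhds x. u0 y = u y 0"
      by eventually_elim (simp add: u0)
    then show ?thesis
      unfolding u_x_def by (rule deriv_cong_ev) simp
  qed
  have u0_cont: "continuous_on {-l<..<l} u0"
    using cont_open[OF t0] by (subst continuous_on_cong[OF refl, of _ _ "\<lambda>x. u x 0"]) (auto simp: u0)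
  have du0_cont: "continuous_on {-l<..<l} (deriv u0)"
    using ux_cont[OF t0] du0 by (subst continuous_on_cong[OF refl, of _ _ "\<lambda>x. u_x u x 0"]) auto
  obtain K' where K': "Linf_norm {-l<..<l} (deriv u0) < ereal K'" "K' < inverse \<epsilon>"
    using ereal_dense2[OF assms(7)] by auto
  have K'_bound: "\<bar>u_x u x 0\<bar> < K'" if "x \<in> {-l<..<l}" for x
    using abs_le_Linf_norm[OF open_greaterThanLessThan du0_cont that] K'(1) du0[OF that]
    by (metis less_ereal.simps(1) order.strict_trans1)
  have K'_pos: "0 < K'"
    using K'_bound[of 0] assms(1) by auto
  have init: "\<bar>u y 0 - u x 0\<bar> \<le> K' * (y - x)" if "-l \<le> x" "x \<le> y" "y \<le> l" for x y
    using lipschitz_of_derivative_bound[OF cont_t[OF t0] du[OF _ t0] less_imp_le[OF K'_bound] that]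
    by simp
  have "\<bar>u l 0 - u (-l) 0\<bar> \<le> K' * (2 * l)"
    using init[of "-l" l] assms(1) by simp
  then obtain ut where "subcritical_solution l \<epsilon> T f u (u_x u) ut"
    using classical_solution_subcritical[OF assms(1-4) _ assms(5) K'(2)] by auto
  then interpret subcritical_solution l \<epsilon> T f u "u_x u" ut .
  obtain L where L: "L < inverse \<epsilon>" "\<And>x y t. -l \<le> x \<Longrightarrow> x \<le> y \<Longrightarrow> y \<le> l \<Longrightarrow> t \<in> {0..T}
      \<Longrightarrow> \<bar>u y t - u x t\<bar> \<le> L * (y - x)"
    using lipschitz_bound[OF K'_pos K'(2) init] by blast
  show ?thesis
  proof (intro ballI conjI)
    fix t assume t: "t \<in> {0..T}"
    have "\<bar>u_x u x t\<bar> \<le> L" if "x \<in> {-l<..<l}" for x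
      using L(2) t by (intro derivative_bound_of_lipschitz[OF _ du[OF that t] that]) auto
    then have "Linf_norm {-l<..<l} (\<lambda>x. u_x u x t) \<le> ereal L"
      by (intro Linf_norm_le ux_cont[OF t]) auto
    also have "\<dots> < ereal (inverse \<epsilon>)"
      using L(1) by simp
    finally show "Linf_norm {-l<..<l} (\<lambda>x. u_x u x t) < ereal (inverse \<epsilon>)" .
    define N where "N = Linf_norm {-l<..<l} u0"
    have N: "ereal \<bar>u x 0\<bar> \<le> N" if "x \<in> {-l<..<l}" for x
      using abs_le_Linf_norm[OF open_greaterThanLessThan u0_cont that] u0[OF that]
      by (simp add: N_def)
    show "Linf_norm {-l<..<l} (\<lambda>x. u x t) \<le> Linf_norm {-l<..<l} u0"
      unfolding N_def[symmetric]
    proof (cases N)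
      case (real r)
      have "\<bar>u x 0\<bar> \<le> r" if "x \<in> {-l..l}" for x
      proof (rule continuous_le_on_closure[where S = "{-l<..<l}" and f = "\<lambda>x. \<bar>u x 0\<bar>"])
        show "continuous_on (closure {-l<..<l}) (\<lambda>x. \<bar>u x 0\<bar>)"
          using cont_t[OF t0] assms(1) by (auto intro!: continuous_intros)
        show "x \<in> closure {-l<..<l}"
          using that assms(1) by simp
        show "\<bar>u y 0\<bar> \<le> r" if "y \<in> {-l<..<l}" for y
          using N[OF that] real by simp
      qed
      then have "\<bar>u x t\<bar> \<le> r" if "x \<in> {-l<..<l}" for x
        using abs_bound[of r x t] that t by auto
      then show "Linf_norm {-l<..<l} (\<lambda>x. u x t) \<le> N"
        using cont_open[OF t] real by (intro Linf_norm_le) auto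
    qed (use N[of 0] assms(1) in auto)
  qed
qed

end
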